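(* Let a parabola and a circle in the Euclidean plane intersect in four points $A$, $B$, $C$ and $D$. Denote by $L$ the intersection point of the diagonals $AC$ and $BD$ of the quadrilateral $ABCD$. Then the bisector of the angle $CLD$ is parallel to the axis of the parabola.
   Formalization: For some labellings the interior bisector of angle CLD is perpendicular to the axis, so the result proved is: the interior bisector is parallel to the axis if the line through L parallel to the axis meets segment CD; otherwise the exterior bisector is. *)

theory Defs
  imports "HOL-Analysis.Analysis"
begin

definition parabola :: "real^2 \<Rightarrow> (real^2) set \<Rightarrow> (real^2) set" where
  \<comment> \<open>focus \<open>F\<close>, directrix \<open>d\<close>; meant for a line \<open>d\<close> with \<open>F \<notin> d\<close>\<close>
  "parabola F d = {P. dist P F = infdist P d}"

definition perpendicular_through :: "real^2 \<Rightarrow> (real^2) set \<Rightarrow> (real^2) set" where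
  "perpendicular_through Q d = {P. \<forall>X\<in>d. \<forall>Y\<in>d. orthogonal (P - Q) (X - Y)}"

definition parabola_axis :: "real^2 \<Rightarrow> (real^2) set \<Rightarrow> (real^2) set" where
  "parabola_axis F d = perpendicular_through F d"

definition angle_at :: "real^2 \<Rightarrow> real^2 \<Rightarrow> real^2 \<Rightarrow> real" where
  \<comment> \<open>unoriented angle \<open>XLY\<close> in \<open>[0, pi]\<close>; meaningful only for \<open>X \<noteq> L\<close> and \<open>Y \<noteq> L\<close>\<close>
  "angle_at X L Y = arccos (((X - L) \<bullet> (Y - L)) / (norm (X - L) * norm (Y - L)))"

text \<open>
  For \<open>X\<close>, \<open>L\<close>, \<open>Y\<close> not collinear, the set below is the open ray from \<open>L\<close> that halves the
  angle \<open>XLY\<close>, so its affine hull is the bisector as a full line through \<open>L\<close>.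
\<close>

definition angle_bisector :: "real^2 \<Rightarrow> real^2 \<Rightarrow> real^2 \<Rightarrow> (real^2) set" where
  "angle_bisector X L Y = affine hull
     {P. P \<noteq> L \<and> angle_at X L P = angle_at X L Y / 2 \<and> angle_at P L Y = angle_at X L Y / 2}"

text \<open>
  The exterior bisector halves the adjacent angle, between the ray \<open>LX\<close> and the ray opposite
  to \<open>LY\<close>; the point \<open>2L - Y\<close> is the reflection of \<open>Y\<close> in \<open>L\<close>.
\<close>

definition exterior_angle_bisector :: "real^2 \<Rightarrow> real^2 \<Rightarrow> real^2 \<Rightarrow> (real^2) set" where
  "exterior_angle_bisector X L Y = angle_bisector X L (2 *\<^sub>R L - Y)"

end

theory Submission
  imports Defs
begin

text \<open>
  In coordinates along and across the directrix the parabola is \<open>2gy = x\<^sup>2 + g\<^sup>2\<close>, so a chord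
  between abscissae \<open>a\<close> and \<open>c\<close> has slope \<open>(a + c) / 2g\<close>. Substituting into the equation of
  the circle gives a quartic in \<open>x\<close> without cubic term; hence the four abscissae add up to zero and
  the diagonals have opposite slopes. A bisector of two such lines is parallel to the axis, the
  interior or the exterior one of \<open>CLD\<close> according to the sides of the vertical line through
  \<open>L\<close> on which \<open>C\<close> and \<open>D\<close> lie.
\<close>

section \<open>Orthonormal frames in the plane\<close>

text \<open>Counterclockwise quarter turn. For a unit direction \<open>u\<close> of the directrix,
  \<open>perp u\<close> is the direction of the axis.\<close>

definition perp :: "real^2 \<Rightarrow> real^2" where
  "perp u = vector [- u$2, u$1]"

lemma inner_real2: "v \<bullet> w = v$1 * w$1 + v$2 * w$2" for v w :: "real^2"
  by (simp add: inner_vec_def sum_2)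

lemma perp_nth [simp]: "perp u $ 1 = - u$2" "perp u $ 2 = u$1"
  by (simp_all add: perp_def)

lemma inner_perp_self [simp]: "u \<bullet> perp u = 0" "perp u \<bullet> u = 0"
  by (simp_all add: inner_real2)

lemma norm_perp [simp]: "norm (perp u) = norm u"
  by (simp add: norm_eq_sqrt_inner inner_real2)

lemma perp_decomp:
  assumes "norm u = 1"
  shows "v = (v \<bullet> u) *\<^sub>R u + (v \<bullet> perp u) *\<^sub>R perp u"
proof -
  have "u$1 * u$1 + u$2 * u$2 = 1"
    using assms by (simp add: norm_eq_1 inner_real2)
  then have "v$1 = (v \<bullet> u) * u$1 + (v \<bullet> perp u) * perp u $ 1"
    and "v$2 = (v \<bullet> u) * u$2 + (v \<bullet> perp u) * perp u $ 2"
    by (simp_all add: inner_real2) algebra+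
  then show ?thesis
    by (simp add: vec_eq_iff forall_2)
qed

lemma inner_perp_decomp:
  assumes "norm u = 1"
  shows "v \<bullet> w = (v \<bullet> u) * (w \<bullet> u) + (v \<bullet> perp u) * (w \<bullet> perp u)"
  by (subst (1) perp_decomp[OF assms, of v])
     (simp only: inner_add_left inner_scaleR_left inner_commute[of w])

text \<open>Both coordinates of \<open>z\<close>, one of them nonzero, annihilate the determinant of
  \<open>w\<close> and \<open>v\<close>. So it vanishes, and \<open>w\<close> is its own projection
  onto the line of \<open>v\<close>.\<close>

lemma orthogonal_complement_real2:
  fixes v w z :: "real^2"
  assumes "z \<noteq> 0" "v \<noteq> 0" "v \<bullet> z = 0" "w \<bullet> z = 0"
  obtains c where "w = c *\<^sub>R v"
proof -
  have v: "v$1 * z$1 + v$2 * z$2 = 0" and w: "w$1 * z$1 + w$2 * z$2 = 0"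
    using assms by (simp_all add: inner_real2)
  have "z$1 \<noteq> 0 \<or> z$2 \<noteq> 0"
    using \<open>z \<noteq> 0\<close> by (auto simp: vec_eq_iff forall_2)
  moreover have "z$1 * (w$1 * v$2 - w$2 * v$1) = 0" "z$2 * (w$1 * v$2 - w$2 * v$1) = 0"
    using v w by algebra+
  ultimately have det: "w$1 * v$2 = w$2 * v$1"
    by auto
  have vv: "v \<bullet> v \<noteq> 0"
    using \<open>v \<noteq> 0\<close> by simp
  have "w$1 * (v \<bullet> v) = (w \<bullet> v) * v$1" "w$2 * (v \<bullet> v) = (w \<bullet> v) * v$2"
    unfolding inner_real2 using det by algebra+
  then have "w = ((w \<bullet> v) / (v \<bullet> v)) *\<^sub>R v"
    using vv by (simp add: vec_eq_iff forall_2 field_simps)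
  then show thesis ..
qed

section \<open>Angles and the bisector as a line\<close>

lemma angle_at_sgn: "angle_at X L Y = arccos (sgn (X - L) \<bullet> sgn (Y - L))"
  by (simp add: angle_at_def sgn_div_norm divide_inverse ac_simps)

lemma inner_unit_bounds:
  fixes v w :: "'a::real_inner"
  assumes "norm v = 1" "norm w = 1"
  shows "\<bar>v \<bullet> w\<bar> \<le> 1"
  using Cauchy_Schwarz_ineq2[of v w] assms by simp

text \<open>This is the double-angle formula read backwards; \<open>0 \<le> c\<close> keeps the
  doubled angle in \<open>[0, pi]\<close>, where \<open>arccos\<close> inverts
  \<open>cos\<close>.\<close>

lemma arccos_half:
  assumes "0 \<le> c" "c \<le> 1"
  shows "arccos (2 * c\<^sup>2 - 1) / 2 = arccos c"
proof -
  have "cos (2 * arccos c) = 2 * c\<^sup>2 - 1"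
    using assms by (simp add: cos_double_cos)
  moreover have "0 \<le> 2 * arccos c" "2 * arccos c \<le> pi"
    using assms arccos_lbound[of c] arccos_le_pi2[of c] by auto
  ultimately have "arccos (2 * c\<^sup>2 - 1) = 2 * arccos c"
    using arccos_cos by metis
  then show ?thesis by simp
qed

text \<open>The unit vectors \<open>e\<close> and \<open>f\<close> span a rhombus whose diagonal
  \<open>e + f\<close> halves the angle. The points with \<open>t > 0\<close> lie in the defining
  set, and every point of that set lies on the line, so the affine hull is the line.\<close>

lemma angle_bisector_eq_line:
  fixes X L Y :: "real^2"
  defines "e \<equiv> sgn (X - L)" and "f \<equiv> sgn (Y - L)"
  assumes "X \<noteq> L" "Y \<noteq> L" "e \<noteq> f" "e + f \<noteq> 0"
  shows "angle_bisector X L Y = range (\<lambda>t. L + t *\<^sub>R (e + f))"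
proof -
  let ?S = "{P. P \<noteq> L \<and> angle_at X L P = angle_at X L Y / 2 \<and> angle_at P L Y = angle_at X L Y / 2}"
  have ne: "norm e = 1" "norm f = 1"
    using assms by (simp_all add: e_def f_def norm_sgn)
  then have ee: "e \<bullet> e = 1" "f \<bullet> f = 1"
    by (simp_all add: norm_eq_1)
  define k where "k = e \<bullet> f"
  have ef: "(e + f) \<bullet> (e + f) = 2 * (1 + k)"
    by (simp add: k_def inner_add_left inner_add_right ee inner_commute)
  have k_pos: "1 + k > 0"
    using inner_gt_zero_iff[of "e + f"] \<open>e + f \<noteq> 0\<close> unfolding ef
    by (simp add: zero_less_mult_iff)
  have k_le: "k \<le> 1"
    using inner_unit_bounds[OF ne] by (simp add: k_def)
  \<comment> \<open>By the half-angle formula \<open>c\<close> is the cosine of half the angle whose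
    cosine is \<open>k\<close>.\<close>
  define c where "c = sqrt ((1 + k) / 2)"
  have c: "0 \<le> c" "c \<le> 1" "c\<^sup>2 = (1 + k) / 2" "c > 0"
    using k_pos k_le by (simp_all add: c_def)
  have norm_ef: "norm (e + f) = 2 * c"
  proof -
    have "(norm (e + f))\<^sup>2 = (2 * c)\<^sup>2"
      by (simp add: power2_norm_eq_inner ef power_mult_distrib c(3))
    then show ?thesis by (rule power2_eq_imp_eq) (use c(1) in simp_all)
  qed
  have half: "angle_at X L Y / 2 = arccos c"
  proof -
    have "2 * c\<^sup>2 - 1 = k" using c(3) by simp
    then show ?thesis
      using arccos_half[OF c(1,2)] by (simp add: angle_at_sgn k_def e_def f_def)
  qed
  have mem: "L + t *\<^sub>R (e + f) \<in> ?S" if "t > 0" for t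
  proof -
    have s: "sgn (L + t *\<^sub>R (e + f) - L) = (e + f) /\<^sub>R (2 * c)"
      using that by (simp add: sgn_scaleR sgn_div_norm[of "e + f"] norm_ef)
    have inner: "e \<bullet> (e + f) = 1 + k" "(e + f) \<bullet> f = 1 + k"
      by (simp_all add: inner_add_left inner_add_right ee k_def)
    have "inverse (2 * c) * (1 + k) = c"
      using c by (simp add: field_simps power2_eq_square)
    then have "e \<bullet> ((e + f) /\<^sub>R (2 * c)) = c" "((e + f) /\<^sub>R (2 * c)) \<bullet> f = c"
      by (simp_all only: inner_scaleR_left inner_scaleR_right inner)
    then have "angle_at X L (L + t *\<^sub>R (e + f)) = arccos c"
      and "angle_at (L + t *\<^sub>R (e + f)) L Y = arccos c"
      by (simp_all only: angle_at_sgn s flip: e_def f_def)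
    moreover have "L + t *\<^sub>R (e + f) \<noteq> L"
      using that \<open>e + f \<noteq> 0\<close> by simp
    ultimately show ?thesis
      unfolding mem_Collect_eq half by blast
  qed
  have sub: "?S \<subseteq> range (\<lambda>t. L + t *\<^sub>R (e + f))"
  proof
    fix P assume P: "P \<in> ?S"
    let ?w = "sgn (P - L)"
    have nw: "norm ?w = 1" using P by (simp add: norm_sgn)
    have "arccos (e \<bullet> ?w) = arccos (?w \<bullet> f)"
      using P by (simp add: angle_at_sgn e_def f_def)
    \<comment> \<open>Equal angles with both sides make \<open>P - L\<close> orthogonal to the other
      diagonal \<open>e - f\<close> of the rhombus, hence a multiple of
      \<open>e + f\<close>.\<close>
    then have "e \<bullet> ?w = ?w \<bullet> f"
      using arccos_eq_iff inner_unit_bounds ne nw by blast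
    then have "?w \<bullet> (e - f) = 0"
      by (simp add: inner_diff_right inner_commute[of e])
    then have "(P - L) \<bullet> (e - f) = 0"
      using P by (simp add: sgn_div_norm)
    moreover have "(e + f) \<bullet> (e - f) = 0"
      by (simp add: inner_add_left inner_diff_right ee inner_commute[of f e])
    moreover have "e - f \<noteq> 0" using assms by simp
    ultimately obtain a where "P - L = a *\<^sub>R (e + f)"
      using orthogonal_complement_real2[of "e - f" "e + f" "P - L"] assms by blast
    then have "P = L + a *\<^sub>R (e + f)" by (metis add.commute diff_add_cancel)
    then show "P \<in> range (\<lambda>t. L + t *\<^sub>R (e + f))" by blast
  qed
  \<comment> \<open>The parameters 1 and 2 are positive, so these two points belong to
    \<open>?S\<close>; they already span the line.\<close>
  have line: "affine hull {L + 1 *\<^sub>R (e + f), L + 2 *\<^sub>R (e + f)} = range (\<lambda>t. L + t *\<^sub>R (e + f))"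
  proof -
    have "(\<lambda>t. L + 1 *\<^sub>R (e + f) + t *\<^sub>R (L + 2 *\<^sub>R (e + f) - (L + 1 *\<^sub>R (e + f))))
        = (\<lambda>t. L + t *\<^sub>R (e + f)) \<circ> (\<lambda>t. t + 1)"
      by (auto simp: algebra_simps scaleR_2)
    moreover have "range (\<lambda>t::real. t + 1) = UNIV"
      using surj_plus_right[of "1::real"] by simp
    ultimately show ?thesis
      by (simp only: affine_hull_2_alt image_comp[symmetric])
  qed
  have "range (\<lambda>t. L + t *\<^sub>R (e + f)) \<subseteq> affine hull ?S"
    unfolding line[symmetric] using mem[of 1] mem[of 2] by (intro hull_mono) auto
  moreover have "affine hull ?S \<subseteq> range (\<lambda>t. L + t *\<^sub>R (e + f))"
    using sub unfolding line[symmetric] by (intro hull_minimal) auto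
  ultimately show ?thesis
    unfolding angle_bisector_def by blast
qed

section \<open>Lines, distances and perpendiculars in a frame\<close>

lemma affine_parallel_lines:
  fixes v w :: "'a::real_vector"
  assumes "v = c *\<^sub>R w" "c \<noteq> 0"
  shows "affine_parallel (range (\<lambda>t. P + t *\<^sub>R v)) (range (\<lambda>t. Q + t *\<^sub>R w))"
proof -
  have "range (\<lambda>t. Q + t *\<^sub>R w) = (\<lambda>x. (Q - P) + x) ` range (\<lambda>t. P + t *\<^sub>R v)"
  proof (intro equalityI subsetI)
    fix x assume "x \<in> range (\<lambda>t. Q + t *\<^sub>R w)"
    then obtain t where "x = Q + t *\<^sub>R w" by blast
    then have "x = (Q - P) + (P + (t / c) *\<^sub>R v)" using assms by simp
    then show "x \<in> (\<lambda>x. (Q - P) + x) ` range (\<lambda>t. P + t *\<^sub>R v)" by blast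
  next
    fix x assume "x \<in> (\<lambda>x. (Q - P) + x) ` range (\<lambda>t. P + t *\<^sub>R v)"
    then obtain t where "x = (Q - P) + (P + t *\<^sub>R v)" by blast
    then have "x = Q + (t * c) *\<^sub>R w" using assms by simp
    then show "x \<in> range (\<lambda>t. Q + t *\<^sub>R w)" by blast
  qed
  then show ?thesis unfolding affine_parallel_def by blast
qed

text \<open>The origin \<open>Q\<close> is chosen as the foot of the perpendicular from
  \<open>F\<close>, which puts the focus at abscissa 0.\<close>

lemma line_frame:
  fixes d :: "(real^2) set"
  assumes "affine d" "aff_dim d = 1"
  obtains Q u where "norm u = 1" "d = range (\<lambda>t. Q + t *\<^sub>R u)" "(F - Q) \<bullet> u = 0"
proof -
  obtain B where B: "affine hull B = affine hull d" "of_nat (card B) = aff_dim d + 1"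
    using aff_dim_basis_exists[of d] by (metis add.commute diff_add_cancel)
  then have "card B = 2" using assms by simp
  then obtain P R where "B = {P, R}" "P \<noteq> R" by (auto simp: card_2_iff)
  then have d: "d = range (\<lambda>t. P + t *\<^sub>R (R - P))"
    using B assms by (metis affine_hull_2_alt affine_hull_eq)
  define u where "u = sgn (R - P)"
  define Q where "Q = P + ((F - P) \<bullet> u) *\<^sub>R u"
  have u: "norm u = 1" using \<open>P \<noteq> R\<close> by (simp add: u_def norm_sgn)
  have RP: "R - P = norm (R - P) *\<^sub>R u" using \<open>P \<noteq> R\<close> by (simp add: u_def sgn_div_norm)
  have "d = range (\<lambda>t. Q + t *\<^sub>R u)"
  proof (intro equalityI subsetI)
    fix x assume "x \<in> d"
    then obtain t where "x = P + t *\<^sub>R (R - P)" using d by blast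
    then have "x = Q + (t * norm (R - P) - (F - P) \<bullet> u) *\<^sub>R u"
      by (subst (asm) RP) (simp add: Q_def scaleR_diff_left)
    then show "x \<in> range (\<lambda>t. Q + t *\<^sub>R u)" by blast
  next
    fix x assume "x \<in> range (\<lambda>t. Q + t *\<^sub>R u)"
    then obtain t where "x = Q + t *\<^sub>R u" by blast
    then have "x = P + ((t + (F - P) \<bullet> u) / norm (R - P)) *\<^sub>R (R - P)"
      using \<open>P \<noteq> R\<close> by (subst (2) RP) (simp add: Q_def scaleR_add_left)
    then show "x \<in> d" using d by blast
  qed
  moreover have "(F - Q) \<bullet> u = 0"
    using u by (simp add: Q_def inner_diff_left inner_add_left norm_eq_1)
  ultimately show thesis using that u by blast
qed

text \<open>The foot of the perpendicular attains the value. No point of the line is closer, by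
  Cauchy-Schwarz with the unit normal, since all points of the line have the same component along
  \<open>perp u\<close>.\<close>

lemma infdist_line:
  assumes u: "norm u = 1"
  shows "infdist P (range (\<lambda>t. Q + t *\<^sub>R u)) = \<bar>(P - Q) \<bullet> perp u\<bar>"
proof (rule antisym)
  let ?d = "range (\<lambda>t. Q + t *\<^sub>R u)"
  have "P - (Q + ((P - Q) \<bullet> u) *\<^sub>R u) = ((P - Q) \<bullet> perp u) *\<^sub>R perp u"
    using perp_decomp[OF u, of "P - Q"] by (simp add: algebra_simps)
  then have "dist P (Q + ((P - Q) \<bullet> u) *\<^sub>R u) = \<bar>(P - Q) \<bullet> perp u\<bar>"
    by (simp add: dist_norm u)
  moreover have "Q + ((P - Q) \<bullet> u) *\<^sub>R u \<in> ?d" by blast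
  ultimately show "infdist P ?d \<le> \<bar>(P - Q) \<bullet> perp u\<bar>"
    by (metis infdist_le)
  have "\<bar>(P - Q) \<bullet> perp u\<bar> \<le> dist P x" if x: "x \<in> ?d" for x
  proof -
    obtain t where "x = Q + t *\<^sub>R u" using x by blast
    then have "(P - Q) \<bullet> perp u = (P - x) \<bullet> perp u"
      by (simp add: inner_diff_left inner_add_left)
    then show ?thesis
      using Cauchy_Schwarz_ineq2[of "P - x" "perp u"] u by (simp add: dist_norm)
  qed
  then show "\<bar>(P - Q) \<bullet> perp u\<bar> \<le> infdist P ?d"
    unfolding infdist_def by (auto intro!: cINF_greatest)
qed

lemma perpendicular_through_line:
  assumes u: "norm u = 1"
  shows "perpendicular_through P (range (\<lambda>t. Q + t *\<^sub>R u)) = {X. (X - P) \<bullet> u = 0}"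
proof (intro equalityI subsetI)
  fix X assume "X \<in> perpendicular_through P (range (\<lambda>t. Q + t *\<^sub>R u))"
  then have "orthogonal (X - P) ((Q + 1 *\<^sub>R u) - (Q + 0 *\<^sub>R u))"
    unfolding perpendicular_through_def by blast
  then show "X \<in> {X. (X - P) \<bullet> u = 0}" by (simp add: orthogonal_def)
next
  fix X assume "X \<in> {X. (X - P) \<bullet> u = 0}"
  then show "X \<in> perpendicular_through P (range (\<lambda>t. Q + t *\<^sub>R u))"
    by (auto simp: perpendicular_through_def orthogonal_def inner_diff_right inner_add_right)
qed

lemma orthogonal_line_eq_range:
  assumes u: "norm u = 1"
  shows "{X. (X - P) \<bullet> u = 0} = range (\<lambda>t. P + t *\<^sub>R perp u)"
proof (intro equalityI subsetI)
  fix X assume "X \<in> {X. (X - P) \<bullet> u = 0}"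
  then have "X - P = ((X - P) \<bullet> perp u) *\<^sub>R perp u"
    using perp_decomp[OF u, of "X - P"] by simp
  then have "X = P + ((X - P) \<bullet> perp u) *\<^sub>R perp u"
    by (metis add.commute diff_add_cancel)
  then show "X \<in> range (\<lambda>t. P + t *\<^sub>R perp u)" by blast
qed (auto simp: inner_diff_left inner_add_left)

section \<open>Bisecting two lines of opposite slopes\<close>

text \<open>The two direction vectors have equal length and are mirror images in the line of
  \<open>perp u\<close>. As \<open>p\<close> and \<open>q\<close> share their sign, the
  \<open>u\<close>-components cancel in the sum of the unit vectors; \<open>m \<noteq> 0\<close>
  keeps the rest nonzero.\<close>

lemma bisector_opposite_slopes:
  assumes u: "norm u = 1"
    and X: "X - L = p *\<^sub>R (u + m *\<^sub>R perp u)"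
    and Y: "Y - L = q *\<^sub>R (m *\<^sub>R perp u - u)"
    and "p * q > 0" "m \<noteq> 0"
  shows "affine_parallel (angle_bisector X L Y) {Z. (Z - P) \<bullet> u = 0}"
proof -
  define s where "s = sqrt (1 + m\<^sup>2)"
  have s: "s > 0" unfolding s_def by (simp add: add_pos_nonneg)
  have uu: "u \<bullet> u = 1" "perp u \<bullet> perp u = 1" using u by (simp_all add: norm_eq_1[symmetric])
  have norms: "norm (u + m *\<^sub>R perp u) = s" "norm (m *\<^sub>R perp u - u) = s"
    by (simp_all add: norm_eq_sqrt_inner s_def inner_add_left inner_add_right inner_diff_left
        inner_diff_right uu power2_eq_square add.commute)
  have pq: "p \<noteq> 0" "q \<noteq> 0" "sgn q = sgn p"
    using \<open>p * q > 0\<close> by (auto simp: zero_less_mult_iff)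
  have e: "sgn (X - L) = (sgn p / s) *\<^sub>R (u + m *\<^sub>R perp u)"
    unfolding X sgn_scaleR by (simp add: sgn_div_norm norms divide_inverse)
  have f: "sgn (Y - L) = (sgn p / s) *\<^sub>R (m *\<^sub>R perp u - u)"
    unfolding Y sgn_scaleR pq(3) by (simp add: sgn_div_norm norms divide_inverse)
  have sum: "sgn (X - L) + sgn (Y - L) = (2 * m * sgn p / s) *\<^sub>R perp u"
    unfolding e f scaleR_add_right[symmetric] by (simp add: algebra_simps scaleR_2[symmetric])
  have "perp u \<noteq> 0" using u by (metis norm_perp norm_zero zero_neq_one)
  have c: "2 * m * sgn p / s \<noteq> 0" using \<open>m \<noteq> 0\<close> pq s by (simp add: sgn_zero_iff)
  have "sgn (X - L) \<bullet> u \<noteq> sgn (Y - L) \<bullet> u"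
    unfolding e f using pq s by (simp add: inner_add_left inner_diff_left uu sgn_zero_iff)
  then have "sgn (X - L) \<noteq> sgn (Y - L)" by metis
  moreover have "sgn (X - L) + sgn (Y - L) \<noteq> 0"
    unfolding sum using c \<open>perp u \<noteq> 0\<close> by simp
  moreover have "X \<noteq> L" "Y \<noteq> L"
    using X Y pq s norms by (metis diff_self less_irrefl norm_zero scaleR_eq_0_iff)+
  ultimately have "angle_bisector X L Y = range (\<lambda>t. L + t *\<^sub>R (sgn (X - L) + sgn (Y - L)))"
    by (intro angle_bisector_eq_line)
  then show ?thesis
    unfolding orthogonal_line_eq_range[OF u] using affine_parallel_lines[OF sum c] by simp
qed

section \<open>Roots of a quartic without cubic term\<close>

text \<open>
  The third divided difference of \<open>x\<^sup>4\<close> is the sum of the nodes, and that of a quadratic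
  vanishes.
\<close>

lemma depressed_quartic_roots_sum:
  fixes a b c d :: "'a::idom"
  assumes dist: "distinct [a, b, c, d]"
    and root: "\<And>x. x \<in> {a, b, c, d} \<Longrightarrow> x^4 + \<alpha> * x^2 + \<beta> * x + \<gamma> = 0"
  shows "a + b + c + d = 0"
proof -
  \<comment> \<open>The divided differences at \<open>a, x\<close>, then \<open>a, b, x\<close>,
    then all four nodes appear as cofactors of node differences, so an integral domain
    suffices.\<close>
  have first: "(a^2 + x^2) * (a + x) + \<alpha> * (a + x) + \<beta> = 0" if "x \<in> {b, c, d}" for x
  proof -
    have "(a - x) * ((a^2 + x^2) * (a + x) + \<alpha> * (a + x) + \<beta>) = 0"
      using root[of a] root[of x] that by simp algebra
    then show ?thesis using dist that by auto
  qed
  have second: "a^2 + a * b + b^2 + x * (a + b + x) + \<alpha> = 0" if "x \<in> {c, d}" for x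
  proof -
    have "(b - x) * (a^2 + a * b + b^2 + x * (a + b + x) + \<alpha>) = 0"
      using first[of b] first[of x] that by simp algebra
    then show ?thesis using dist that by auto
  qed
  have "(c - d) * (a + b + c + d) = 0"
    using second[of c] second[of d] by simp algebra
  then show ?thesis using dist by auto
qed

section \<open>Parabola, circle and chords in coordinates\<close>

text \<open>With directrix \<open>y = 0\<close> and focus \<open>(0, g)\<close>, squaring the
  distances gives \<open>x^2 + (y - g)^2 = y^2\<close>, where \<open>y^2\<close> cancels.\<close>

lemma parabola_coordinates:
  assumes u: "norm u = 1" and F: "(F - Q) \<bullet> u = 0"
    and P: "P \<in> parabola F (range (\<lambda>t. Q + t *\<^sub>R u))"
  shows "2 * ((F - Q) \<bullet> perp u) * ((P - Q) \<bullet> perp u)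
    = ((P - Q) \<bullet> u)\<^sup>2 + ((F - Q) \<bullet> perp u)\<^sup>2"
proof -
  have "norm (P - F) = \<bar>(P - Q) \<bullet> perp u\<bar>"
    using P by (simp add: parabola_def infdist_line[OF u] dist_norm)
  then have "(P - F) \<bullet> (P - F) = ((P - Q) \<bullet> perp u)\<^sup>2"
    by (metis power2_abs power2_norm_eq_inner)
  moreover have "(P - F) \<bullet> u = (P - Q) \<bullet> u"
    and "(P - F) \<bullet> perp u = (P - Q) \<bullet> perp u - (F - Q) \<bullet> perp u"
    using F by (simp_all add: inner_diff_left)
  ultimately show ?thesis
    unfolding inner_perp_decomp[OF u, of "P - F" "P - F"]
    by (simp add: power2_eq_square algebra_simps)
qed

lemma sphere_coordinates:
  assumes u: "norm u = 1" and P: "P \<in> sphere M r"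
  shows "((P - Q) \<bullet> u - (M - Q) \<bullet> u)\<^sup>2 + ((P - Q) \<bullet> perp u - (M - Q) \<bullet> perp u)\<^sup>2 = r\<^sup>2"
proof -
  have "(P - M) \<bullet> (P - M) = r\<^sup>2"
    using P by (simp add: dist_norm norm_minus_commute flip: power2_norm_eq_inner)
  then show ?thesis
    unfolding inner_perp_decomp[OF u, of "P - M" "P - M"]
    by (simp add: power2_eq_square inner_diff_left)
qed

text \<open>Subtracting the two equations and factoring the difference of squares gives the slope of
  \<open>AC\<close>, and \<open>C - L\<close> is a multiple of \<open>C - A\<close>. The product
  form avoids division.\<close>

lemma chord_slope:
  fixes A C L Q u n :: "'a::real_inner"
  assumes L: "L \<in> affine hull {A, C}"
    and A: "K * ((A - Q) \<bullet> n) = ((A - Q) \<bullet> u)\<^sup>2 + k"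
    and C: "K * ((C - Q) \<bullet> n) = ((C - Q) \<bullet> u)\<^sup>2 + k"
  shows "K * ((C - L) \<bullet> n) = ((A - Q) \<bullet> u + (C - Q) \<bullet> u) * ((C - L) \<bullet> u)"
proof -
  obtain t where "L = A + t *\<^sub>R (C - A)"
    using L by (auto simp: affine_hull_2_alt)
  then have CL: "C - L = (1 - t) *\<^sub>R ((C - Q) - (A - Q))"
    by (simp add: algebra_simps)
  show ?thesis
    unfolding CL inner_scaleR_left inner_diff_left[of "C - Q" "A - Q"]
    using A C by algebra
qed

text \<open>The component of \<open>X - L\<close> along \<open>u\<close> is affine along the
  segment, with nonzero end values; it has a zero there exactly when these have opposite
  signs.\<close>

lemma closed_segment_meets_orthogonal_line:
  fixes C D L u :: "'a::real_inner"
  assumes "(C - L) \<bullet> u \<noteq> 0" "(D - L) \<bullet> u \<noteq> 0"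
  shows "closed_segment C D \<inter> {X. (X - L) \<bullet> u = 0} \<noteq> {}
    \<longleftrightarrow> ((C - L) \<bullet> u) * ((D - L) \<bullet> u) < 0"
proof -
  define p q where "p = (C - L) \<bullet> u" and "q = (D - L) \<bullet> u"
  have pq: "p \<noteq> 0" "q \<noteq> 0" using assms by (simp_all add: p_def q_def)
  have "((1 - t) *\<^sub>R C + t *\<^sub>R D - L) \<bullet> u = (1 - t) * p + t * q" for t
    by (simp add: p_def q_def inner_diff_left inner_add_left algebra_simps)
  then have "closed_segment C D \<inter> {X. (X - L) \<bullet> u = 0} \<noteq> {}
    \<longleftrightarrow> (\<exists>t. 0 \<le> t \<and> t \<le> 1 \<and> (1 - t) * p + t * q = 0)"
    by (force simp: closed_segment_def)
  also have "\<dots> \<longleftrightarrow> p * q < 0"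
  proof
    assume "\<exists>t. 0 \<le> t \<and> t \<le> 1 \<and> (1 - t) * p + t * q = 0"
    then obtain t where t: "0 \<le> t" "t \<le> 1" and eq: "(1 - t) * p + t * q = 0" by blast
    have "t \<noteq> 0" using eq pq by auto
    have "t * (p * q) = - ((1 - t) * (p * p))" using eq by algebra
    then have "t * (p * q) \<le> 0" using t by simp
    then have "p * q \<le> 0" using t \<open>t \<noteq> 0\<close> by (simp add: mult_le_0_iff)
    then show "p * q < 0" using pq by (simp add: less_le)
  next
    assume "p * q < 0"
    \<comment> \<open>\<open>p / (p - q)\<close> is the zero of the affine function with values
      \<open>p\<close> at 0 and \<open>q\<close> at 1.\<close>
    then have "0 \<le> p / (p - q)" "p / (p - q) \<le> 1" "p - q \<noteq> 0"
      by (auto simp: mult_less_0_iff field_simps)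
    moreover from this have "(1 - p / (p - q)) * p + p / (p - q) * q = 0"
      by (simp add: field_simps)
    ultimately show "\<exists>t. 0 \<le> t \<and> t \<le> 1 \<and> (1 - t) * p + t * q = 0" by blast
  qed
  finally show ?thesis by (simp add: p_def q_def)
qed

section \<open>The four common points and their diagonals\<close>

theorem corollary2:
  fixes F M A B C D L :: "real^2" and d :: "(real^2) set" and r :: real
  assumes "affine d" and "aff_dim d = 1" and "F \<notin> d"
    and "r > 0"
    and "distinct [A, B, C, D]"
    and "parabola F d \<inter> sphere M r = {A, B, C, D}"
    and "affine hull {A, C} \<inter> affine hull {B, D} = {L}"
  shows "if closed_segment C D \<inter> perpendicular_through L d \<noteq> {}
         then affine_parallel (angle_bisector C L D) (parabola_axis F d)
         else affine_parallel (exterior_angle_bisector C L D) (parabola_axis F d)"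
proof -
  obtain Q u where u: "norm u = 1" and d: "d = range (\<lambda>t. Q + t *\<^sub>R u)"
    and F: "(F - Q) \<bullet> u = 0"
    using line_frame[OF assms(1,2), of F] by blast
  define n where "n = perp u"
  define g where "g = (F - Q) \<bullet> n"
  define K where "K = 2 * g"
  define x y where "x P = (P - Q) \<bullet> u" and "y P = (P - Q) \<bullet> n" for P
  have decomp: "v = (v \<bullet> u) *\<^sub>R u + (v \<bullet> n) *\<^sub>R n" for v
    unfolding n_def by (rule perp_decomp[OF u])
  have "g \<noteq> 0"
  proof
    assume "g = 0"
    then have "F - Q = 0" using decomp[of "F - Q"] F by (simp add: g_def)
    then have "F = Q + 0 *\<^sub>R u" by simp
    then show False using \<open>F \<notin> d\<close> d by blast
  qed
  then have K: "K \<noteq> 0" by (simp add: K_def)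
  have on_parabola: "K * y P = (x P)\<^sup>2 + g\<^sup>2" if "P \<in> {A, B, C, D}" for P
    using parabola_coordinates[OF u F, of P] that assms(6)
    unfolding d K_def g_def n_def x_def y_def by blast
  have on_circle: "(x P - x M)\<^sup>2 + (y P - y M)\<^sup>2 = r\<^sup>2" if "P \<in> {A, B, C, D}" for P
    using sphere_coordinates[OF u, of P M r Q] that assms(6)
    unfolding n_def x_def y_def by blast
  \<comment> \<open>On the parabola the abscissa determines the ordinate because
    \<open>K \<noteq> 0\<close>, so the quartic has four distinct roots.\<close>
  have inj: "P = R" if "P \<in> {A, B, C, D}" "R \<in> {A, B, C, D}" "x P = x R" for P R
  proof -
    have "y P = y R" using on_parabola[OF that(1)] on_parabola[OF that(2)] that(3) K
      by (metis mult_left_cancel)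
    then have "P - Q = R - Q"
      using decomp[of "P - Q"] decomp[of "R - Q"] that(3) by (simp add: x_def y_def)
    then show ?thesis by simp
  qed
  have "inj_on x {A, B, C, D}"
    by (rule inj_onI) (rule inj)
  then have "distinct (map x [A, B, C, D])"
    using assms(5) by (simp only: distinct_map list.set simp_thms)
  then have dist: "distinct [x A, x B, x C, x D]"
    by (simp only: list.map)
  \<comment> \<open>The circle equation is multiplied by \<open>K^2\<close> and
    \<open>K * y P\<close> replaced by \<open>(x P)^2 + g^2\<close>. A cubic term cannot arise,
    since the square of the ordinate difference has only even powers of \<open>x P\<close>.\<close>
  have "(x P)^4 + (K\<^sup>2 + 2 * (g\<^sup>2 - K * y M)) * (x P)^2 + (- 2 * K\<^sup>2 * x M) * x P
      + (K\<^sup>2 * (x M)\<^sup>2 + (g\<^sup>2 - K * y M)\<^sup>2 - K\<^sup>2 * r\<^sup>2) = 0" if "P \<in> {A, B, C, D}" for P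
  proof -
    have "K\<^sup>2 * ((x P - x M)\<^sup>2 + (y P - y M)\<^sup>2) = K\<^sup>2 * r\<^sup>2"
      using on_circle[OF that] by simp
    then have "K\<^sup>2 * (x P - x M)\<^sup>2 + (K * y P - K * y M)\<^sup>2 = K\<^sup>2 * r\<^sup>2"
      by (simp only: distrib_left power_mult_distrib flip: right_diff_distrib)
    then show ?thesis
      unfolding on_parabola[OF that] by (simp add: power2_eq_square power4_eq_xxxx algebra_simps)
  qed
  then have sum: "x A + x B + x C + x D = 0"
    by (intro depressed_quartic_roots_sum[OF dist]) blast
  have chord: "K * ((R - L') \<bullet> n) = (x P + x R) * ((R - L') \<bullet> u)"
    if "P \<in> {A, B, C, D}" "R \<in> {A, B, C, D}" "L' \<in> affine hull {P, R}" for P R L'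
    using chord_slope[OF that(3)] on_parabola[OF that(1)] on_parabola[OF that(2)]
    unfolding x_def y_def by blast
  \<comment> \<open>A line meets the parabola at most twice: comparing the slopes of
    \<open>PR\<close> and \<open>RS\<close> forces \<open>x S\<close> to equal \<open>x P\<close> or
    \<open>x R\<close>.\<close>
  have not_collinear: "S \<notin> affine hull {P, R}"
    if "P \<in> {A, B, C, D}" "R \<in> {A, B, C, D}" "S \<in> {A, B, C, D}" "S \<noteq> P" "S \<noteq> R" for P R S
  proof
    assume "S \<in> affine hull {P, R}"
    from chord[OF that(1,2) this] have "K * (y R - y S) = (x P + x R) * (x R - x S)"
      by (simp add: x_def y_def inner_diff_left)
    moreover have "K * (y R - y S) = (x R + x S) * (x R - x S)"
      using on_parabola[OF that(2)] on_parabola[OF that(3)] by algebra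
    ultimately have "(x P - x S) * (x R - x S) = 0" by algebra
    then have "x P = x S \<or> x R = x S" by simp
    then show False
      using inj[OF that(1,3)] inj[OF that(2,3)] that(4,5) by metis
  qed
  \<comment> \<open>The slope of \<open>AC\<close> in the frame; that of \<open>BD\<close> is
    \<open>- m\<close>.\<close>
  define m where "m = (x A + x C) / K"
  have L: "L \<in> affine hull {A, C}" "L \<in> affine hull {B, D}" using assms(7) by auto
  have C_slope: "K * ((C - L) \<bullet> n) = (x A + x C) * ((C - L) \<bullet> u)"
    and "K * ((D - L) \<bullet> n) = (x B + x D) * ((D - L) \<bullet> u)"
    using chord L by blast+
  moreover have "x B + x D = - (x A + x C)" using sum by simp
  ultimately have D_slope: "K * ((D - L) \<bullet> n) = - (x A + x C) * ((D - L) \<bullet> u)"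
    by simp
  define p q where "p = (C - L) \<bullet> u" and "q = (D - L) \<bullet> u"
  have "(C - L) \<bullet> n = p * m" "(D - L) \<bullet> n = - q * m"
    using C_slope D_slope K by (simp_all add: p_def q_def m_def field_simps)
  then have CL: "C - L = p *\<^sub>R (u + m *\<^sub>R n)" and DL: "D - L = (- q) *\<^sub>R (m *\<^sub>R n - u)"
    using decomp[of "C - L"] decomp[of "D - L"]
    by (simp_all add: p_def[symmetric] q_def[symmetric] scaleR_add_right scaleR_diff_right)
  \<comment> \<open>Otherwise \<open>C\<close> would be a third common point on the line
    \<open>BD\<close>.\<close>
  have "C \<noteq> L" using not_collinear[of B D C] L assms(5) by auto
  then have p: "p \<noteq> 0" using CL by auto
  have "D \<noteq> L" using not_collinear[of A C D] L assms(5) by auto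
  then have q: "q \<noteq> 0" using DL by auto
  \<comment> \<open>If both diagonals were parallel to the directrix, passing through
    \<open>L\<close> would give \<open>C\<close> and \<open>D\<close> the same ordinate. Then
    \<open>x D\<close> would be \<open>x C\<close> or \<open>- x C\<close>, which is
    \<open>x A\<close>.\<close>
  have m: "m \<noteq> 0"
  proof
    assume "m = 0"
    then have "x A + x C = 0" using K by (simp add: m_def)
    then have "K * (y C - y D) = 0"
      using C_slope D_slope K by (simp add: y_def inner_diff_left)
    then have "(x C)\<^sup>2 = (x D)\<^sup>2" using on_parabola[of C] on_parabola[of D] by simp algebra
    then have "x C = x D \<or> x A = x D"
      using \<open>x A + x C = 0\<close> by (auto simp: power2_eq_iff)
    then show False using dist by simp
  qed
  have axis: "parabola_axis F d = {X. (X - F) \<bullet> u = 0}"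
    unfolding parabola_axis_def d perpendicular_through_line[OF u] ..
  have meets: "closed_segment C D \<inter> perpendicular_through L d \<noteq> {} \<longleftrightarrow> p * q < 0"
    unfolding d perpendicular_through_line[OF u] p_def q_def
    using closed_segment_meets_orthogonal_line p q unfolding p_def q_def by blast
  show ?thesis
  proof (cases "p * q < 0")
    case True
    then have "p * (- q) > 0" by simp
    from bisector_opposite_slopes[OF u CL[unfolded n_def] DL[unfolded n_def] this m]
    show ?thesis using True meets axis by simp
  next
    case False
    then have "p * q > 0" using p q by (simp add: not_less less_le)
    \<comment> \<open>Reflecting \<open>D\<close> in \<open>L\<close> flips the coefficient
      \<open>- q\<close> to \<open>q\<close>, which now has the sign of \<open>p\<close>.\<close>
    moreover have "2 *\<^sub>R L - D - L = q *\<^sub>R (m *\<^sub>R n - u)"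
      using DL by (simp add: algebra_simps scaleR_2)
    ultimately show ?thesis
      using bisector_opposite_slopes[OF u CL[unfolded n_def], of "2 *\<^sub>R L - D" q F] m False
      by (simp add: meets axis exterior_angle_bisector_def n_def)
  qed
qed

end
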